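(* Let $K$ be a countable (infinite) field, let $(F_N)$ be a double F\o lner sequence in $K$, and let $E\subset K$ satisfy $\bar d_{(F_N)}(E)>0$. Then for each $\epsilon>0$ there is a set $D\subset K^*$ such that $$\underline d_{(F_N)}(D)\geq\frac{\epsilon}{\epsilon+\bar d_{(F_N)}(E)-\bar d_{(F_N)}(E)^2}$$ and for all $u\in D$, $$\bar d_{(F_N)}\big((E-u)\cap(E/u)\big)>\bar d_{(F_N)}(E)^2-\epsilon.$$
   Context: A double F\o lner sequence in $K$ is a sequence $(F_N)$ of non-empty finite subsets of $K$ such that for each $x\in K^*=K\setminus\{0\}$, $\lim_N|F_N\cap(F_N+x)|/|F_N|=\lim_N|F_N\cap(xF_N)|/|F_N|=1$. For $S\subset K$: $\bar d_{(F_N)}(S)=\limsup_{N}|S\cap F_N|/|F_N|$ and $\underline d_{(F_N)}(S)=\liminf_{N}|S\cap F_N|/|F_N|$. Also $E-u=\{x-u:x\in E\}$ and $E/u=\{x/u:x\in E\}$. *)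

theory Defs
  imports "HOL-Analysis.Analysis"
begin

definition double_Folner :: "(nat \<Rightarrow> 'a::field set) \<Rightarrow> bool" where
  "double_Folner F \<longleftrightarrow>
     (\<forall>N. finite (F N) \<and> F N \<noteq> {}) \<and>
     (\<forall>x. x \<noteq> 0 \<longrightarrow>
        (\<lambda>N. real (card (F N \<inter> (\<lambda>y. y + x) ` F N)) / real (card (F N))) \<longlonglongrightarrow> 1 \<and>
        (\<lambda>N. real (card (F N \<inter> (\<lambda>y. x * y) ` F N)) / real (card (F N))) \<longlonglongrightarrow> 1)"

text \<open>
  The upper and lower limits are taken in the complete lattice of extended reals, since
  limsup and liminf are not available on the reals. The ratios lie between 0 and 1 when the
  sets \<open>F N\<close> are finite and non-empty, so the conversion back to the reals loses nothing.
\<close>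

definition upper_dens :: "(nat \<Rightarrow> 'a set) \<Rightarrow> 'a set \<Rightarrow> real" where
  "upper_dens F S =
     real_of_ereal (limsup (\<lambda>N. ereal (real (card (S \<inter> F N)) / real (card (F N)))))"

definition lower_dens :: "(nat \<Rightarrow> 'a set) \<Rightarrow> 'a set \<Rightarrow> real" where
  "lower_dens F S =
     real_of_ereal (liminf (\<lambda>N. ereal (real (card (S \<inter> F N)) / real (card (F N)))))"

end

theory Submission
  imports Defs
begin

text \<open>
  Let \<open>m\<close> be a cluster point of the averages over \<open>F N\<close> along a subsequence attaining the upper
  density \<open>d\<close> of \<open>E\<close>; it is an affinely invariant mean with \<open>m f = d\<close> for the indicator \<open>f\<close> of
  \<open>E\<close>, and \<open>\<phi> u = m (f (x + u) * f (x * u))\<close> is at most the upper density of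
  \<open>(E - u) \<inter> (E / u)\<close>. Since \<open>\<phi> \<le> d\<close>, the bound on the lower density of
  \<open>{u. \<phi> u > d\<^sup>2 - \<epsilon>}\<close> follows by counting once the averages of \<open>\<phi>\<close> over the whole sequence
  \<open>F N\<close> are shown to be asymptotically at least \<open>d\<^sup>2\<close>.

  This is an ergodic theorem in which finite averages replace the orthogonal projections to
  invariant vectors. Replace \<open>f\<close> by an average \<open>g\<close> of its translates that is nearly translation
  invariant; the error \<open>f - g\<close> does not contribute, by van der Corput's trick for the
  multiplicative group. By invariance of \<open>g\<close> only \<open>m (g (x / u) * f x)\<close> has to be averaged over
  \<open>u\<close>, so \<open>g\<close> can be replaced by an average \<open>q\<close> of its dilates that is nearly dilation
  invariant too. Then \<open>m (q * f)\<close> is close to \<open>m (q * q) \<ge> (m q)\<^sup>2 = d\<^sup>2\<close>.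
\<close>

section \<open>Bounded functions and finite averages\<close>

definition avg :: "'a set \<Rightarrow> ('a \<Rightarrow> real) \<Rightarrow> real" where
  "avg A f = (\<Sum>x\<in>A. f x) / real (card A)"

definition bdd_fun :: "('a \<Rightarrow> real) \<Rightarrow> bool" where
  "bdd_fun f \<longleftrightarrow> (\<exists>C. \<forall>x. \<bar>f x\<bar> \<le> C)"

named_theorems bdd_intros

lemma bdd_funI: "(\<And>x. \<bar>f x\<bar> \<le> C) \<Longrightarrow> bdd_fun f"
  by (auto simp: bdd_fun_def)

lemma bdd_fun_const [bdd_intros]: "bdd_fun (\<lambda>x. c)"
  by (auto simp: bdd_fun_def)

lemma bdd_fun_add [bdd_intros]:
  assumes "bdd_fun f" "bdd_fun g" shows "bdd_fun (\<lambda>x. f x + g x)"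
proof -
  obtain C D where "\<And>x. \<bar>f x\<bar> \<le> C" "\<And>x. \<bar>g x\<bar> \<le> D"
    using assms unfolding bdd_fun_def by blast
  then have "\<And>x. \<bar>f x + g x\<bar> \<le> C + D"
    by (meson abs_triangle_ineq add_mono order_trans)
  then show ?thesis by (rule bdd_funI)
qed

lemma bdd_fun_mult [bdd_intros]:
  assumes "bdd_fun f" "bdd_fun g" shows "bdd_fun (\<lambda>x. f x * g x)"
proof -
  obtain C D where "\<And>x. \<bar>f x\<bar> \<le> C" "\<And>x. \<bar>g x\<bar> \<le> D"
    using assms unfolding bdd_fun_def by blast
  then have "\<And>x. \<bar>f x * g x\<bar> \<le> C * D"
    by (metis abs_ge_zero abs_mult mult_mono order_trans)
  then show ?thesis by (rule bdd_funI)
qed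

lemma bdd_fun_diff [bdd_intros]:
  assumes "bdd_fun f" "bdd_fun g" shows "bdd_fun (\<lambda>x. f x - g x)"
  using bdd_fun_add[OF assms(1) bdd_fun_mult[OF bdd_fun_const[of "-1"] assms(2)]] by simp

lemma bdd_fun_divide [bdd_intros]:
  assumes "bdd_fun f" shows "bdd_fun (\<lambda>x. f x / c)"
  using bdd_fun_mult[OF assms bdd_fun_const[of "inverse c"]] by (simp add: divide_inverse)

lemma bdd_fun_power2 [bdd_intros]:
  assumes "bdd_fun f" shows "bdd_fun (\<lambda>x. (f x)\<^sup>2)"
  using bdd_fun_mult[OF assms assms] by (simp add: power2_eq_square)

lemma bdd_fun_compose: "bdd_fun f \<Longrightarrow> bdd_fun (\<lambda>x. f (t x))"
  by (auto simp: bdd_fun_def)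

lemma bdd_fun_sum [bdd_intros]:
  assumes "\<And>i. i \<in> A \<Longrightarrow> bdd_fun (f i)" shows "bdd_fun (\<lambda>x. \<Sum>i\<in>A. f i x)"
  using assms by (induction A rule: infinite_finite_induct) (auto intro: bdd_intros)

lemma bdd_fun_avg [bdd_intros]:
  assumes "\<And>i. i \<in> A \<Longrightarrow> bdd_fun (f i)" shows "bdd_fun (\<lambda>x. avg A (\<lambda>i. f i x))"
  unfolding avg_def using assms by (intro bdd_intros)

section \<open>Linearity, monotonicity and variance of finite averages\<close>

lemma avg_add: "avg A (\<lambda>x. f x + g x) = avg A f + avg A g"
  by (simp add: avg_def sum.distrib add_divide_distrib)

lemma avg_diff: "avg A (\<lambda>x. f x - g x) = avg A f - avg A g"
  by (simp add: avg_def sum_subtractf diff_divide_distrib)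

lemma avg_cmult: "avg A (\<lambda>x. c * f x) = c * avg A f"
  by (simp add: avg_def sum_distrib_left)

lemma avg_mono: "(\<And>x. x \<in> A \<Longrightarrow> f x \<le> g x) \<Longrightarrow> avg A f \<le> avg A g"
  by (simp add: avg_def sum_mono divide_right_mono)

lemma avg_const: "finite A \<Longrightarrow> A \<noteq> {} \<Longrightarrow> avg A (\<lambda>x. c) = c"
  by (simp add: avg_def)

lemma avg_swap: "avg A (\<lambda>x. avg B (\<lambda>y. f x y)) = avg B (\<lambda>y. avg A (\<lambda>x. f x y))"
  by (simp add: avg_def sum_divide_distrib [symmetric] sum.swap[of f] mult.commute)

lemma abs_avg_le:
  assumes "0 \<le> C" "\<And>x. x \<in> A \<Longrightarrow> \<bar>f x\<bar> \<le> C" shows "\<bar>avg A f\<bar> \<le> C"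
proof (cases "finite A \<and> A \<noteq> {}")
  case True
  then have "avg A f \<le> C" "avg A (\<lambda>x. - C) \<le> avg A f"
    using avg_mono[of A f "\<lambda>x. C"] avg_mono[of A "\<lambda>x. - C" f] assms(2)
    by (force simp: avg_const abs_le_iff)+
  with True show ?thesis by (simp add: avg_const)
next
  case False
  then show ?thesis using assms(1) by (auto simp: avg_def)
qed

text \<open>The difference of the two sides is the variance of \<open>f\<close> on \<open>A\<close>,
  an average of squares.\<close>

lemma avg_power2_le: "(avg A f)\<^sup>2 \<le> avg A (\<lambda>x. (f x)\<^sup>2)"
proof (cases "finite A \<and> A \<noteq> {}")
  case True
  have "0 \<le> avg A (\<lambda>x. (f x - avg A f)\<^sup>2)"
    by (simp add: avg_def sum_nonneg)
  also have "(\<lambda>x. (f x - avg A f)\<^sup>2) = (\<lambda>x. (f x)\<^sup>2 + ((- 2 * avg A f) * f x + (avg A f)\<^sup>2))"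
    by (simp add: fun_eq_iff power2_eq_square algebra_simps)
  also have "avg A \<dots> = avg A (\<lambda>x. (f x)\<^sup>2) - (avg A f)\<^sup>2"
    using True unfolding avg_add avg_cmult by (simp add: avg_const power2_eq_square)
  finally show ?thesis by simp
qed (auto simp: avg_def)

text \<open>The sums over \<open>A\<close> and over \<open>T\<close>
  A\<open>share the terms of the intersection. As\<close>T\<open>is injective, each leftover has\<close>card
  A - card (A \<inter> T \<open>A)\<close> terms, every one of size at most
  \<open>C\<close>.\<close>

lemma avg_comp_diff_le:
  fixes \<psi> :: "'a \<Rightarrow> real"
  assumes "finite A" "inj T" "\<And>y. \<bar>\<psi> y\<bar> \<le> C"
  shows "\<bar>avg A (\<lambda>u. \<psi> (T u)) - avg A \<psi>\<bar> \<le> 2 * C * (1 - real (card (A \<inter> T ` A)) / real (card A))"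
proof (cases "A = {}")
  case True
  have "0 \<le> C" using assms(3)[of undefined] by simp
  then show ?thesis using True by (simp add: avg_def)
next
  case False
  let ?I = "A \<inter> T ` A"
  have fin: "finite (T ` A)" using assms(1) by simp
  have cT: "card (T ` A) = card A"
    using assms(2) by (simp add: card_image inj_on_subset)
  have "(\<Sum>u\<in>A. \<psi> (T u)) = sum \<psi> (T ` A)"
    using assms(2) by (subst sum.reindex) (auto intro: inj_on_subset)
  also have "\<dots> = sum \<psi> ?I + sum \<psi> (T ` A - A)"
    using fin by (subst sum.Int_Diff[of _ _ A]) (auto simp: Int_commute)
  finally have 1: "(\<Sum>u\<in>A. \<psi> (T u)) = sum \<psi> ?I + sum \<psi> (T ` A - A)" .
  have 2: "sum \<psi> A = sum \<psi> ?I + sum \<psi> (A - T ` A)"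
    using assms(1) by (rule sum.Int_Diff)
  have b: "\<bar>sum \<psi> B\<bar> \<le> C * real (card B)" for B
    using order_trans[OF sum_abs[of \<psi> B] sum_bounded_above[of B "\<lambda>y. \<bar>\<psi> y\<bar>" C]] assms(3)
    by (simp add: mult.commute)
  have c1: "real (card (T ` A - A)) = real (card A) - real (card ?I)"
    using card_Diff_subset_Int[of "T ` A" A] fin assms(1) cT card_mono[of A ?I]
    by (simp add: Int_commute of_nat_diff)
  have c2: "real (card (A - T ` A)) = real (card A) - real (card ?I)"
    using card_Diff_subset_Int[of A "T ` A"] fin assms(1) card_mono[of A ?I]
    by (simp add: of_nat_diff)
  have "\<bar>(\<Sum>u\<in>A. \<psi> (T u)) - sum \<psi> A\<bar> \<le> 2 * C * (real (card A) - real (card ?I))"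
    using b[of "T ` A - A"] b[of "A - T ` A"] unfolding 1 2 c1 c2 by (simp add: algebra_simps)
  moreover have "card A > 0" using False assms(1) by (simp add: card_gt_0_iff)
  ultimately have "\<bar>(\<Sum>u\<in>A. \<psi> (T u)) - sum \<psi> A\<bar> / real (card A)
      \<le> 2 * C * (real (card A) - real (card ?I)) / real (card A)"
    by (intro divide_right_mono) auto
  also have "\<dots> = 2 * C * (1 - real (card ?I) / real (card A))"
    using \<open>card A > 0\<close> by (simp add: field_simps)
  finally show ?thesis
    by (simp add: avg_def diff_divide_distrib[symmetric])
qed

section \<open>Asymptotic invariance along a double Folner sequence\<close>

text \<open>The threshold for \<open>N\<close> depends on \<open>\<psi>\<close> only through its
  bound \<open>C\<close>. This uniformity allows whole families of functions to be treated at once,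
  such as one \<open>\<psi>\<close> for each point \<open>x\<close> under a mean.\<close>

definition asym_inv :: "(nat \<Rightarrow> 'a set) \<Rightarrow> ('a \<Rightarrow> 'a) \<Rightarrow> bool" where
  "asym_inv F T \<longleftrightarrow> (\<forall>C. \<forall>e>0. \<forall>\<^sub>F N in sequentially. \<forall>\<psi>. (\<forall>y. \<bar>\<psi> y\<bar> \<le> C) \<longrightarrow>
     \<bar>avg (F N) (\<lambda>u. \<psi> (T u)) - avg (F N) \<psi>\<bar> \<le> e)"

lemma asym_invD:
  assumes "asym_inv F T" "e > 0"
  shows "\<forall>\<^sub>F N in sequentially. \<forall>\<psi>. (\<forall>y. \<bar>\<psi> y\<bar> \<le> C) \<longrightarrow>
     \<bar>avg (F N) (\<lambda>u. \<psi> (T u)) - avg (F N) \<psi>\<bar> \<le> e"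
  using assms unfolding asym_inv_def by blast

lemma asym_inv_id: "asym_inv F (\<lambda>x. x)"
  by (simp add: asym_inv_def)

lemma asym_invI:
  assumes "inj T" "\<And>N. finite (F N)"
    and lim: "(\<lambda>N. real (card (F N \<inter> T ` F N)) / real (card (F N))) \<longlonglongrightarrow> 1"
  shows "asym_inv F T"
  unfolding asym_inv_def
proof (intro allI impI)
  fix C e :: real assume "e > 0"
  have "(\<lambda>N. 2 * C * (1 - real (card (F N \<inter> T ` F N)) / real (card (F N)))) \<longlonglongrightarrow> 2 * C * (1 - 1)"
    by (intro tendsto_intros lim)
  then have "\<forall>\<^sub>F N in sequentially. 2 * C * (1 - real (card (F N \<inter> T ` F N)) / real (card (F N))) < e"
    using \<open>e > 0\<close> by (simp add: order_tendstoD(2))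
  then show "\<forall>\<^sub>F N in sequentially. \<forall>\<psi>. (\<forall>y. \<bar>\<psi> y\<bar> \<le> C) \<longrightarrow>
     \<bar>avg (F N) (\<lambda>u. \<psi> (T u)) - avg (F N) \<psi>\<bar> \<le> e"
  proof eventually_elim
    case (elim N)
    show ?case
    proof (intro allI impI)
      fix \<psi> :: "'a \<Rightarrow> real" assume "\<forall>y. \<bar>\<psi> y\<bar> \<le> C"
      then show "\<bar>avg (F N) (\<lambda>u. \<psi> (T u)) - avg (F N) \<psi>\<bar> \<le> e"
        using avg_comp_diff_le[OF assms(2)[of N] assms(1), of \<psi> C] elim by fastforce
    qed
  qed
qed

lemma double_Folner_translation:
  assumes "double_Folner F" shows "asym_inv F (\<lambda>y. y + s)"
proof (cases "s = 0")
  case False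
  then show ?thesis
    using assms by (intro asym_invI) (auto simp: double_Folner_def inj_def)
qed (simp add: asym_inv_id)

lemma double_Folner_dilation:
  assumes "double_Folner F" "c \<noteq> 0" shows "asym_inv F (\<lambda>y. c * y)"
  using assms by (intro asym_invI) (auto simp: double_Folner_def inj_def)

text \<open>The \<open>k\<close> translates of a point by distinct elements are disjoint, so their
  averages sum to at most 1, while each is asymptotically the average of the point itself. An
  infinite field supplies arbitrarily large \<open>k\<close>. The point 0 is thus negligible, which
  absorbs every failure of an identity involving division by \<open>u\<close>.\<close>

lemma double_Folner_singleton:
  fixes F :: "nat \<Rightarrow> 'a::field set"
  assumes "double_Folner F" "infinite (UNIV :: 'a set)" "e > 0"
  shows "\<forall>\<^sub>F N in sequentially. avg (F N) (indicator {0}) \<le> e"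
proof -
  obtain k :: nat where k: "k > 0" "inverse (real k) < e / 2"
    using reals_Archimedean2[of "2 / e"] \<open>e > 0\<close>
    by (metis half_gt_zero real_arch_inverse neq0_conv)
  obtain X :: "'a set" where X: "finite X" "card X = k"
    using infinite_arbitrarily_large[OF assms(2)] by blast
  then have "X \<noteq> {}" using k by auto
  have "\<forall>\<^sub>F N in sequentially. \<forall>x\<in>X. \<forall>\<psi>. (\<forall>y. \<bar>\<psi> y\<bar> \<le> 1) \<longrightarrow>
     \<bar>avg (F N) (\<lambda>u. \<psi> (u + x)) - avg (F N) \<psi>\<bar> \<le> e / 2"
    using \<open>e > 0\<close> X by (intro eventually_ball_finite ballI asym_invD double_Folner_translation assms) auto
  then show ?thesis
  proof eventually_elim
    case (elim N)
    have fin: "finite (F N)" "F N \<noteq> {}" using assms(1) by (auto simp: double_Folner_def)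
    have "avg (F N) (indicator {0}) - e / 2 = avg X (\<lambda>x. avg (F N) (indicator {0}) - e / 2)"
      using X \<open>X \<noteq> {}\<close> by (simp add: avg_const)
    also have "\<dots> \<le> avg X (\<lambda>x. avg (F N) (\<lambda>u. indicator {0} (u + x)))"
    proof (rule avg_mono)
      fix x assume "x \<in> X"
      have "\<forall>y::'a. \<bar>indicator {0} y :: real\<bar> \<le> 1" by (simp add: indicator_def)
      with elim \<open>x \<in> X\<close>
      have "\<bar>avg (F N) (\<lambda>u. indicator {0} (u + x)) - avg (F N) (indicator {0})\<bar> \<le> e / 2"
        by blast
      then show "avg (F N) (indicator {0}) - e / 2 \<le> avg (F N) (\<lambda>u. indicator {0} (u + x))"
        by linarith
    qed
    also have "\<dots> = avg (F N) (\<lambda>u. avg X (\<lambda>x. indicator {0} (u + x)))"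
      by (rule avg_swap)
    also have "\<dots> \<le> avg (F N) (\<lambda>u. inverse (real k))"
    proof (rule avg_mono)
      fix u
      have "(\<Sum>x\<in>X. indicator {0} (u + x)) = (\<Sum>x\<in>X. if x = - u then 1 else 0 :: real)"
        by (intro sum.cong) (auto simp: indicator_def add_eq_0_iff)
      also have "\<dots> \<le> 1" using X by simp
      finally show "avg X (\<lambda>x. indicator {0} (u + x)) \<le> inverse (real k)"
        using X k by (simp add: avg_def divide_simps)
    qed
    also have "\<dots> \<le> e / 2" using k fin by (simp add: avg_const)
    finally show ?case by simp
  qed
qed

lemma avg_diff_le_singleton:
  assumes "0 \<le> C" "\<And>u. \<bar>\<phi> u - \<psi> u\<bar> \<le> C" "\<And>u. u \<noteq> 0 \<Longrightarrow> \<phi> u = \<psi> u"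
  shows "\<bar>avg A \<phi> - avg A \<psi>\<bar> \<le> C * avg A (indicator {0::'a::zero})"
proof -
  have le: "\<phi> u - \<psi> u \<le> C * indicator {0} u" "- (C * indicator {0} u) \<le> \<phi> u - \<psi> u" for u
    using assms(2)[of u] assms(3)[of u] by (auto simp: indicator_def abs_le_iff)
  have "avg A (\<lambda>u. \<phi> u - \<psi> u) \<le> avg A (\<lambda>u. C * indicator {0} u)"
    "avg A (\<lambda>u. (- C) * indicator {0} u) \<le> avg A (\<lambda>u. \<phi> u - \<psi> u)"
    using le by (auto intro!: avg_mono)
  then show ?thesis
    unfolding avg_diff avg_cmult by (simp add: abs_le_iff)
qed

section \<open>Means\<close>

text \<open>A finitely additive integral in functional form. It takes the place of a probability
  measure, with \<open>m (\<lambda>x. f x * g x)\<close> as the inner product.\<close>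

locale mean =
  fixes m :: "('a \<Rightarrow> real) \<Rightarrow> real"
  assumes m_add: "\<And>f g. bdd_fun f \<Longrightarrow> bdd_fun g \<Longrightarrow> m (\<lambda>x. f x + g x) = m f + m g"
    and m_cmult: "\<And>c f. bdd_fun f \<Longrightarrow> m (\<lambda>x. c * f x) = c * m f"
    and m_mono: "\<And>f g. bdd_fun f \<Longrightarrow> bdd_fun g \<Longrightarrow> (\<And>x. f x \<le> g x) \<Longrightarrow> m f \<le> m g"
    and m_one: "m (\<lambda>x. 1) = 1"
begin

lemma m_const [simp]: "m (\<lambda>x. c) = c"
  using m_cmult[OF bdd_fun_const, of c 1] m_one by simp

lemma m_diff: "bdd_fun f \<Longrightarrow> bdd_fun g \<Longrightarrow> m (\<lambda>x. f x - g x) = m f - m g"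
  using m_add[of f "\<lambda>x. (-1) * g x"] m_cmult[of g "-1"] bdd_fun_mult[OF bdd_fun_const[of "-1"], of g]
  by simp

lemma m_divide: "bdd_fun f \<Longrightarrow> m (\<lambda>x. f x / c) = m f / c"
  using m_cmult[of f "inverse c"] by (simp add: divide_inverse mult.commute)

lemma m_sum:
  assumes "\<And>i. i \<in> A \<Longrightarrow> bdd_fun (f i)"
  shows "m (\<lambda>x. \<Sum>i\<in>A. f i x) = (\<Sum>i\<in>A. m (f i))"
  using assms
  by (induction A rule: infinite_finite_induct) (auto simp: m_add bdd_fun_sum)

lemma m_avg:
  assumes "\<And>i. i \<in> A \<Longrightarrow> bdd_fun (f i)"
  shows "m (\<lambda>x. avg A (\<lambda>i. f i x)) = avg A (\<lambda>i. m (f i))"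
  using assms by (simp add: avg_def m_divide m_sum bdd_fun_sum)

lemma abs_m_le:
  assumes "\<And>x. \<bar>f x\<bar> \<le> C" shows "\<bar>m f\<bar> \<le> C"
proof -
  have "bdd_fun f" using assms by (rule bdd_funI)
  then have "m f \<le> C" "m (\<lambda>x. - C) \<le> m f"
    using m_mono[OF _ bdd_fun_const, of f C] m_mono[OF bdd_fun_const, of f "- C"] assms
    by (auto simp: abs_le_iff minus_le_iff)
  then show ?thesis by simp
qed

lemma m_nonneg: "bdd_fun f \<Longrightarrow> (\<And>x. 0 \<le> f x) \<Longrightarrow> 0 \<le> m f"
  using m_mono[OF bdd_fun_const, of f 0] by simp

lemma m_power2_le:
  assumes f: "bdd_fun f" shows "(m f)\<^sup>2 \<le> m (\<lambda>x. (f x)\<^sup>2)"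
proof -
  have "0 \<le> m (\<lambda>x. (f x - m f)\<^sup>2)"
    by (intro m_nonneg bdd_intros f) auto
  also have "(\<lambda>x. (f x - m f)\<^sup>2) = (\<lambda>x. (f x)\<^sup>2 + ((- 2 * m f) * f x + (m f)\<^sup>2))"
    by (simp add: fun_eq_iff power2_eq_square algebra_simps)
  also have "m \<dots> = m (\<lambda>x. (f x)\<^sup>2) + (m (\<lambda>x. (- 2 * m f) * f x) + (m f)\<^sup>2)"
    by (subst m_add, (intro bdd_intros f)+)+ simp
  also have "\<dots> = m (\<lambda>x. (f x)\<^sup>2) - (m f)\<^sup>2"
    using m_cmult[OF f, of "- 2 * m f"] by (simp add: power2_eq_square)
  finally show ?thesis by simp
qed

text \<open>A weak Cauchy-Schwarz inequality: squaring moves inside the mean by positivity of the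
  variance, and \<open>f\<close> is then bounded by 1. A function of small norm may be dropped from
  any correlation with \<open>f\<close>.\<close>

lemma abs_m_mult_le:
  assumes k: "bdd_fun k" "m (\<lambda>x. (k x)\<^sup>2) \<le> \<eta>\<^sup>2" "0 \<le> \<eta>" and f: "\<And>x. \<bar>f x\<bar> \<le> 1"
  shows "\<bar>m (\<lambda>x. k x * f x)\<bar> \<le> \<eta>"
proof -
  have bf: "bdd_fun f" using f by (rule bdd_funI)
  have "(m (\<lambda>x. k x * f x))\<^sup>2 \<le> m (\<lambda>x. (k x * f x)\<^sup>2)"
    by (intro m_power2_le bdd_intros bf k)
  also have "\<dots> \<le> m (\<lambda>x. (k x)\<^sup>2)"
  proof (intro m_mono bdd_intros bf k)
    fix x
    have "(k x)\<^sup>2 * (f x)\<^sup>2 \<le> (k x)\<^sup>2 * 1"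
      using f[of x] by (intro mult_left_mono) (auto simp: abs_square_le_1)
    then show "(k x * f x)\<^sup>2 \<le> (k x)\<^sup>2" by (simp add: power_mult_distrib)
  qed
  finally have "(m (\<lambda>x. k x * f x))\<^sup>2 \<le> \<eta>\<^sup>2" using k(2) by linarith
  then show ?thesis using k(3) by (metis abs_le_square_iff abs_of_nonneg)
qed

end

section \<open>Midpoint hulls of orbits and almost invariant functions\<close>

text \<open>Midpoints suffice in place of general convex combinations of the functions \<open>f \<circ> t\<close>.\<close>

inductive_set mids :: "('a \<Rightarrow> 'a) set \<Rightarrow> ('a \<Rightarrow> real) \<Rightarrow> ('a \<Rightarrow> real) set"
  for T :: "('a \<Rightarrow> 'a) set" and f :: "'a \<Rightarrow> real" where
  base: "t \<in> T \<Longrightarrow> (\<lambda>x. f (t x)) \<in> mids T f"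
| mid: "p \<in> mids T f \<Longrightarrow> q \<in> mids T f \<Longrightarrow> (\<lambda>x. (p x + q x) / 2) \<in> mids T f"

lemma mids_bounds:
  assumes "p \<in> mids T f" "\<And>x. a \<le> f x" "\<And>x. f x \<le> b"
  shows "a \<le> p x \<and> p x \<le> b"
  using assms(1)
proof (induction arbitrary: x)
  case (mid p q)
  from mid.IH(1)[of x] mid.IH(2)[of x] show ?case by auto
qed (use assms in auto)

lemma bdd_fun_mids:
  assumes "p \<in> mids T f" "bdd_fun f" shows "bdd_fun p"
  using assms(1) by induction (auto intro!: bdd_intros bdd_fun_compose[OF assms(2)])

lemma mids_compose:
  assumes "p \<in> mids T f" "\<And>s t. s \<in> T \<Longrightarrow> t \<in> T \<Longrightarrow> (\<lambda>x. t (s x)) \<in> T" "s \<in> T"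
  shows "(\<lambda>x. p (s x)) \<in> mids T f"
  using assms(1)
proof induction
  case (base t)
  show ?case using mids.base[OF assms(2)[OF assms(3) base]] .
next
  case (mid p q)
  from mid.IH show ?case by (rule mids.mid)
qed

text \<open>Applying \<open>t\<close> to the value \<open>\<rho> i u\<close> amounts to moving the
  parameter \<open>u\<close> by \<open>S\<close>, which the averages over \<open>F N\<close> do not
  notice, uniformly in \<open>i\<close>. Midpoints keep the bound by the triangle inequality. The
  maps used for \<open>\<rho>\<close> are \<open>y + k * u\<close> for translations and
  \<open>x / u\<close> for dilations.\<close>

lemma mids_asym_inv:
  assumes "p \<in> mids T f" "\<And>x. \<bar>f x\<bar> \<le> C"
    and "\<And>t. t \<in> T \<Longrightarrow> \<exists>S. asym_inv F S \<and> (\<forall>i u. t (\<rho> i u) = \<rho> i (S u))"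
    and "e > 0"
  shows "\<forall>\<^sub>F N in sequentially. \<forall>i. \<bar>avg (F N) (\<lambda>u. f (\<rho> i u) - p (\<rho> i u))\<bar> \<le> e"
  using assms(1)
proof induction
  case (base t)
  then obtain S where S: "asym_inv F S" "\<And>i u. t (\<rho> i u) = \<rho> i (S u)"
    using assms(3) by blast
  from asym_invD[OF S(1) \<open>e > 0\<close>, of C] show ?case
  proof eventually_elim
    case (elim N)
    show ?case
    proof
      fix i
      have "\<bar>avg (F N) (\<lambda>u. f (\<rho> i (S u))) - avg (F N) (\<lambda>u. f (\<rho> i u))\<bar> \<le> e"
        using elim[rule_format, of "\<lambda>u. f (\<rho> i u)"] assms(2) by simp
      then show "\<bar>avg (F N) (\<lambda>u. f (\<rho> i u) - f (t (\<rho> i u)))\<bar> \<le> e"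
        unfolding S(2) avg_diff by linarith
    qed
  qed
next
  case (mid p q)
  from mid.IH show ?case
  proof eventually_elim
    case (elim N)
    show ?case
    proof
      fix i
      have "avg (F N) (\<lambda>u. f (\<rho> i u) - (p (\<rho> i u) + q (\<rho> i u)) / 2)
          = avg (F N) (\<lambda>u. (1/2) * (f (\<rho> i u) - p (\<rho> i u)) + (1/2) * (f (\<rho> i u) - q (\<rho> i u)))"
        by (intro arg_cong[where f = "avg (F N)"] ext) (simp add: field_simps)
      also have "\<dots> = (1/2) * avg (F N) (\<lambda>u. f (\<rho> i u) - p (\<rho> i u))
          + (1/2) * avg (F N) (\<lambda>u. f (\<rho> i u) - q (\<rho> i u))"
        by (simp only: avg_add avg_cmult)
      finally show "\<bar>avg (F N) (\<lambda>u. f (\<rho> i u) - (p (\<rho> i u) + q (\<rho> i u)) / 2)\<bar> \<le> e"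
        using elim(1)[rule_format, of i] elim(2)[rule_format, of i] by linarith
    qed
  qed
qed

context mean
begin

definition preserving :: "('a \<Rightarrow> 'a) \<Rightarrow> bool" where
  "preserving t \<longleftrightarrow> (\<forall>f. bdd_fun f \<longrightarrow> m (\<lambda>x. f (t x)) = m f)"

lemma preservingD: "preserving t \<Longrightarrow> bdd_fun f \<Longrightarrow> m (\<lambda>x. f (t x)) = m f"
  by (simp add: preserving_def)

lemma m_mids:
  assumes "p \<in> mids T f" "bdd_fun f" "\<And>t. t \<in> T \<Longrightarrow> preserving t"
  shows "m p = m f"
  using assms(1)
proof induction
  case (mid p q)
  then show ?case
    using bdd_fun_mids[OF mid(1) assms(2)] bdd_fun_mids[OF mid(2) assms(2)]
    by (simp add: m_divide m_add bdd_fun_add)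
qed (use assms in \<open>auto simp: preservingD\<close>)

text \<open>A near minimiser of the norm is nearly invariant by the parallelogram law.\<close>

lemma mids_near_invariant:
  assumes "bdd_fun f" "T \<noteq> {}" "\<eta> > 0"
    and pres: "\<And>t. t \<in> T \<Longrightarrow> preserving t"
    and comp: "\<And>s t. s \<in> T \<Longrightarrow> t \<in> T \<Longrightarrow> (\<lambda>x. t (s x)) \<in> T"
  shows "\<exists>p\<in>mids T f. \<forall>t\<in>T. m (\<lambda>x. (p x - p (t x))\<^sup>2) \<le> \<eta>\<^sup>2"
proof -
  define V where "V = (\<lambda>p. m (\<lambda>x. (p x)\<^sup>2)) ` mids T f"
  have bdd: "bdd_fun p" if "p \<in> mids T f" for p
    using bdd_fun_mids[OF that assms(1)] .
  have "V \<noteq> {}" using assms(2) mids.base[of _ T f] unfolding V_def by blast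
  have below: "bdd_below V"
    unfolding V_def by (intro bdd_belowI[of _ 0]) (blast intro: m_nonneg bdd_fun_power2 bdd zero_le_power2)
  \<comment> \<open>The parallelogram law multiplies the excess over the infimum by 4, hence the
    margin \<open>\<eta>^2 / 4\<close>.\<close>
  have "Inf V < Inf V + \<eta>\<^sup>2 / 4" using \<open>\<eta> > 0\<close> by simp
  then obtain v where "v \<in> V" "v < Inf V + \<eta>\<^sup>2 / 4"
    using cInf_lessD[OF \<open>V \<noteq> {}\<close>] by blast
  then obtain p where p: "p \<in> mids T f" "m (\<lambda>x. (p x)\<^sup>2) < Inf V + \<eta>\<^sup>2 / 4"
    by (auto simp: V_def)
  note bp = bdd[OF p(1)]
  show ?thesis
  proof (intro bexI[OF _ p(1)] ballI)
    fix t assume t: "t \<in> T"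
    have pt: "(\<lambda>x. p (t x)) \<in> mids T f" by (rule mids_compose[OF p(1) _ t]) (rule comp)
    have bpt: "bdd_fun (\<lambda>x. p (t x))" using bdd[OF pt] .
    have "Inf V \<le> m (\<lambda>x. ((p x + p (t x)) / 2)\<^sup>2)"
      using below mids.mid[OF p(1) pt] unfolding V_def by (intro cInf_lower) auto
    moreover have "m (\<lambda>x. (p (t x))\<^sup>2) = m (\<lambda>x. (p x)\<^sup>2)"
      using preservingD[OF pres[OF t] bdd_fun_power2[OF bp]] .
    moreover have "m (\<lambda>x. (p x - p (t x))\<^sup>2)
        = m (\<lambda>x. 2 * (p x)\<^sup>2 + 2 * (p (t x))\<^sup>2 - 4 * ((p x + p (t x)) / 2)\<^sup>2)"
      by (intro arg_cong[where f = m] ext) (simp add: power2_eq_square field_simps)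
    moreover have "\<dots> = 2 * m (\<lambda>x. (p x)\<^sup>2) + 2 * m (\<lambda>x. (p (t x))\<^sup>2)
        - 4 * m (\<lambda>x. ((p x + p (t x)) / 2)\<^sup>2)"
      by (simp add: m_add m_diff m_cmult bdd_intros bp bpt)
    ultimately show "m (\<lambda>x. (p x - p (t x))\<^sup>2) \<le> \<eta>\<^sup>2"
      using p(2) by linarith
  qed
qed

text \<open>Invariance of \<open>m\<close> moves \<open>t\<close> from \<open>f\<close> onto
  \<open>q\<close> as its inverse \<open>s\<close>, and \<open>q\<close> is nearly fixed by
  \<open>s\<close>. Almost invariant functions therefore cannot distinguish \<open>f\<close> from
  its averages, just as invariant vectors cannot distinguish a vector from its projection.\<close>

lemma mids_inner:
  assumes p: "p \<in> mids T f" and q: "bdd_fun q" and f: "\<And>x. \<bar>f x\<bar> \<le> 1" and "0 \<le> \<eta>"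
    and pres: "\<And>t. t \<in> T \<Longrightarrow> preserving t"
    and inv: "\<And>t. t \<in> T \<Longrightarrow> \<exists>s\<in>T. \<forall>x. t (s x) = x"
    and near: "\<And>t. t \<in> T \<Longrightarrow> m (\<lambda>x. (q x - q (t x))\<^sup>2) \<le> \<eta>\<^sup>2"
  shows "\<bar>m (\<lambda>x. q x * f x) - m (\<lambda>x. q x * p x)\<bar> \<le> \<eta>"
  using p
proof induction
  case (base t)
  have bf: "bdd_fun f" using f by (rule bdd_funI)
  from inv[OF base] obtain s where s: "s \<in> T" "\<And>x. t (s x) = x" by blast
  note b = bdd_fun_compose[OF q, of s] bdd_fun_compose[OF bf, of t]
  have "m (\<lambda>x. q x * f (t x)) = m (\<lambda>x. q (s x) * f (t (s x)))"
    using preservingD[OF pres[OF s(1)], of "\<lambda>x. q x * f (t x)"] by (simp add: bdd_intros q b)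
  also have "\<dots> = m (\<lambda>x. q (s x) * f x)" by (simp add: s)
  finally have "m (\<lambda>x. q x * f x) - m (\<lambda>x. q x * f (t x)) = m (\<lambda>x. (q x - q (s x)) * f x)"
    by (simp add: left_diff_distrib m_diff bdd_intros q b bf)
  moreover have "\<bar>m (\<lambda>x. (q x - q (s x)) * f x)\<bar> \<le> \<eta>"
    by (intro abs_m_mult_le bdd_intros q b near s f \<open>0 \<le> \<eta>\<close>)
  ultimately show ?case by simp
next
  case (mid p p')
  have bf: "bdd_fun f" using f by (rule bdd_funI)
  have "m (\<lambda>x. q x * ((p x + p' x) / 2)) = (m (\<lambda>x. q x * p x) + m (\<lambda>x. q x * p' x)) / 2"
    using bdd_fun_mids[OF mid(1) bf] bdd_fun_mids[OF mid(2) bf]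
    by (simp add: distrib_left m_divide m_add bdd_intros q)
  then show ?case using mid.IH by argo
qed

end

section \<open>Affinely invariant means\<close>

text \<open>The mean integrates over the variable \<open>x\<close>, while \<open>F\<close> averages
  over the parameter \<open>u\<close>. No relation between \<open>m\<close> and \<open>F\<close> is
  assumed, so estimates in \<open>u\<close> hold along the whole sequence even when \<open>m\<close>
  arises from a subsequence.\<close>

locale affine_mean = mean m for m :: "('a::field \<Rightarrow> real) \<Rightarrow> real" +
  fixes F :: "nat \<Rightarrow> 'a set"
  assumes Folner: "double_Folner F" and infinite_field: "infinite (UNIV :: 'a set)"
    and translation: "\<And>s. preserving (\<lambda>x. x + s)"
    and dilation: "\<And>c. c \<noteq> 0 \<Longrightarrow> preserving (\<lambda>x. c * x)"
begin

lemma finite_Folner [simp]: "finite (F N)" and Folner_nonempty [simp]: "F N \<noteq> {}"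
  using Folner by (auto simp: double_Folner_def)

section \<open>Van der Corput's trick for the multiplicative group\<close>

text \<open>
  The substitution \<open>x \<mapsto> u * x - c\<^sup>2 * u\<close> turns the correlation into
  \<open>h (x / b + k * u) * h (x / c)\<close> with \<open>k = (b\<^sup>2 - c\<^sup>2) / b\<close>. It fails at \<open>u = 0\<close>, which has
  density zero.
\<close>

lemma van_der_Corput_correlation:
  assumes h: "\<And>x. \<bar>h x\<bar> \<le> 1"
    and unif: "\<And>k e. k \<noteq> 0 \<Longrightarrow> e > 0 \<Longrightarrow> \<forall>\<^sub>F N in sequentially. \<forall>y. \<bar>avg (F N) (\<lambda>u. h (y + k * u))\<bar> \<le> e"
    and bc: "b \<noteq> 0" "c \<noteq> 0" "b\<^sup>2 \<noteq> c\<^sup>2" and "e > 0"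
  shows "\<forall>\<^sub>F N in sequentially.
    avg (F N) (\<lambda>u. m (\<lambda>x. h (x / (b * u) + b * u) * h (x / (c * u) + c * u))) \<le> e"
proof -
  define k where "k = (b\<^sup>2 - c\<^sup>2) / b"
  have "k \<noteq> 0" using bc by (simp add: k_def)
  have bh: "bdd_fun h" using h by (rule bdd_funI)
  note bhc = bdd_fun_compose[OF bh]
  define \<phi> where "\<phi> = (\<lambda>u. m (\<lambda>x. h (x / (b * u) + b * u) * h (x / (c * u) + c * u)))"
  define \<psi> where "\<psi> = (\<lambda>u. m (\<lambda>x. h (x / b + k * u) * h (x / c)))"
  have le1: "\<bar>h x * h y\<bar> \<le> 1" for x y
    using mult_mono[OF h[of x] h[of y]] by (simp add: abs_mult)
  have eq: "\<phi> u = \<psi> u" if "u \<noteq> 0" for u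
  proof -
    have "\<phi> u = m (\<lambda>x. h ((u * x) / (b * u) + b * u) * h ((u * x) / (c * u) + c * u))"
      unfolding \<phi>_def using that
      by (intro preservingD[OF dilation, symmetric] bdd_intros bhc)
    also have "\<dots> = m (\<lambda>x. h (x / b + b * u) * h (x / c + c * u))"
      using that by simp
    also have "\<dots> = m (\<lambda>x. h ((x + (- (c\<^sup>2 * u))) / b + b * u) * h ((x + (- (c\<^sup>2 * u))) / c + c * u))"
      by (intro preservingD[OF translation, symmetric] bdd_intros bhc)
    also have "(\<lambda>x. h ((x + (- (c\<^sup>2 * u))) / b + b * u)) = (\<lambda>x. h (x / b + k * u))"
      using bc by (intro ext arg_cong[where f = h]) (simp add: k_def field_simps power2_eq_square)
    also have "(\<lambda>x. h ((x + (- (c\<^sup>2 * u))) / c + c * u)) = (\<lambda>x. h (x / c))"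
      using bc by (intro ext arg_cong[where f = h]) (simp add: field_simps power2_eq_square)
    finally show ?thesis by (simp add: \<psi>_def)
  qed
  have diff: "\<bar>\<phi> u - \<psi> u\<bar> \<le> 2" for u
  proof -
    have "\<bar>\<phi> u\<bar> \<le> 1" "\<bar>\<psi> u\<bar> \<le> 1"
      unfolding \<phi>_def \<psi>_def by (intro abs_m_le le1)+
    then show ?thesis by linarith
  qed
  have "\<forall>\<^sub>F N in sequentially. avg (F N) (indicator {0}) \<le> e / 4"
    using \<open>e > 0\<close> by (intro double_Folner_singleton Folner infinite_field) auto
  moreover have "\<forall>\<^sub>F N in sequentially. \<forall>y. \<bar>avg (F N) (\<lambda>u. h (y + k * u))\<bar> \<le> e / 2"
    using \<open>e > 0\<close> \<open>k \<noteq> 0\<close> by (intro unif) auto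
  ultimately have "\<forall>\<^sub>F N in sequentially. avg (F N) \<phi> \<le> e"
  proof eventually_elim
    case (elim N)
    have "\<bar>avg (F N) \<phi> - avg (F N) \<psi>\<bar> \<le> 2 * avg (F N) (indicator {0})"
      by (intro avg_diff_le_singleton diff eq) auto
    moreover have "avg (F N) \<psi> = m (\<lambda>x. avg (F N) (\<lambda>u. h (x / b + k * u) * h (x / c)))"
      unfolding \<psi>_def by (intro m_avg[symmetric] bdd_intros bhc)
    \<comment> \<open>The shift \<open>x / b\<close> varies under the mean, so the bound in
      \<open>unif\<close> has to be uniform in \<open>y\<close>.\<close>
    moreover have "\<bar>m (\<lambda>x. avg (F N) (\<lambda>u. h (x / b + k * u) * h (x / c)))\<bar> \<le> e / 2"
    proof (rule abs_m_le)
      fix x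
      have "avg (F N) (\<lambda>u. h (x / b + k * u) * h (x / c)) = h (x / c) * avg (F N) (\<lambda>u. h (x / b + k * u))"
        by (simp add: avg_cmult[symmetric] mult.commute)
      also have "\<bar>\<dots>\<bar> \<le> 1 * (e / 2)"
        unfolding abs_mult using h elim(2) by (intro mult_mono) auto
      finally show "\<bar>avg (F N) (\<lambda>u. h (x / b + k * u) * h (x / c))\<bar> \<le> e / 2" by simp
    qed
    ultimately show ?case using elim(1) by linarith
  qed
  then show ?thesis unfolding \<phi>_def .
qed

text \<open>Squaring has fibres of at most two elements, so an infinite field has infinitely many
  nonzero squares; choose one root of each. Distinct squares are what makes
  \<open>k = (b^2 - c^2) / b\<close> nonzero in the correlation estimate, in every
  characteristic.\<close>

lemma finite_distinct_squares:
  obtains B :: "'a set" where "finite B" "card B = n" "0 \<notin> B" "inj_on (\<lambda>b. b\<^sup>2) B"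
proof -
  define Q where "Q = (\<lambda>b::'a. b\<^sup>2) ` (UNIV - {0})"
  have "infinite Q"
  proof
    assume "finite Q"
    moreover have "finite {b \<in> UNIV - {0}. b\<^sup>2 = z}" for z :: 'a
    proof (cases "\<exists>c. c\<^sup>2 = z")
      case True
      then obtain c where "c\<^sup>2 = z" by blast
      then have "{b \<in> UNIV - {0}. b\<^sup>2 = z} \<subseteq> {c, - c}" by (auto simp: power2_eq_iff)
      then show ?thesis using finite_subset by blast
    qed auto
    ultimately have "finite (\<Union>z\<in>Q. {b \<in> UNIV - {0}. b\<^sup>2 = z})" by blast
    moreover have "(\<Union>z\<in>Q. {b \<in> UNIV - {0}. b\<^sup>2 = z}) = UNIV - {0}" by (auto simp: Q_def)
    ultimately show False using infinite_field by simp
  qed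
  then obtain X where X: "X \<subseteq> Q" "finite X" "card X = n"
    by (meson infinite_arbitrarily_large)
  from X(1) obtain B where B: "B \<subseteq> UNIV - {0}" "inj_on (\<lambda>b. b\<^sup>2) B" "X = (\<lambda>b. b\<^sup>2) ` B"
    unfolding Q_def subset_image_inj by blast
  show ?thesis
  proof (rule that)
    show "finite B" using X(2) B(2,3) by (simp add: finite_image_iff)
    show "card B = n" using X(3) B(2,3) by (simp add: card_image)
    show "0 \<notin> B" "inj_on (\<lambda>b. b\<^sup>2) B" using B by auto
  qed
qed

text \<open>Dilation invariance of \<open>F\<close> replaces the average over \<open>u\<close> by an
  average over \<open>b * u\<close> for \<open>b\<close> in a finite set \<open>B\<close>.
  Cauchy-Schwarz removes \<open>f\<close> and leaves the correlations of pairs from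
  \<open>B\<close>: the diagonal contributes \<open>1 / n\<close>, and distinct pairs are
  asymptotically at most \<open>\<delta>\<close>.\<close>

lemma van_der_Corput:
  assumes h: "\<And>x. \<bar>h x\<bar> \<le> 1" and f: "\<And>x. \<bar>f x\<bar> \<le> 1"
    and unif: "\<And>k e. k \<noteq> 0 \<Longrightarrow> e > 0 \<Longrightarrow> \<forall>\<^sub>F N in sequentially. \<forall>y. \<bar>avg (F N) (\<lambda>u. h (y + k * u))\<bar> \<le> e"
    and "e > 0"
  shows "\<forall>\<^sub>F N in sequentially. \<bar>avg (F N) (\<lambda>u. m (\<lambda>x. h (x / u + u) * f x))\<bar> \<le> e"
proof -
  define a where "a u x = h (x / u + u)" for u x
  have bh: "bdd_fun h" and bf: "bdd_fun f" using h f by (auto intro: bdd_funI)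
  have ba: "bdd_fun (a u)" for u
    unfolding a_def by (rule bdd_fun_compose[OF bh])
  have a1: "\<bar>a u x\<bar> \<le> 1" for u x using h by (simp add: a_def)
  \<comment> \<open>Chosen so that \<open>\<delta> + 1 / n < 2 * \<delta> = (e / 2)^2\<close>; the
    other \<open>e / 2\<close> pays for the passage to dilates.\<close>
  define \<delta> where "\<delta> = e\<^sup>2 / 8"
  have "\<delta> > 0" using \<open>e > 0\<close> by (simp add: \<delta>_def)
  obtain n :: nat where n: "n > 0" "inverse (real n) < \<delta>"
    using real_arch_inverse \<open>\<delta> > 0\<close> by (metis neq0_conv)
  obtain B :: "'a set" where B: "finite B" "card B = n" "0 \<notin> B" "inj_on (\<lambda>b. b\<^sup>2) B"
    using finite_distinct_squares .
  have "B \<noteq> {}" using B n by auto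
  have ev1: "\<forall>\<^sub>F N in sequentially. \<forall>b\<in>B. \<forall>\<psi>. (\<forall>y. \<bar>\<psi> y\<bar> \<le> 1) \<longrightarrow>
      \<bar>avg (F N) (\<lambda>u. \<psi> (b * u)) - avg (F N) \<psi>\<bar> \<le> e / 2"
    using B \<open>e > 0\<close>
    by (intro eventually_ball_finite ballI asym_invD double_Folner_dilation Folner) auto
  have ev2: "\<forall>\<^sub>F N in sequentially. \<forall>b\<in>B. \<forall>c\<in>B. b \<noteq> c \<longrightarrow>
      avg (F N) (\<lambda>u. m (\<lambda>x. a (b * u) x * a (c * u) x)) \<le> \<delta>"
  proof (intro eventually_ball_finite ballI B)
    fix b c assume bc: "b \<in> B" "c \<in> B"
    show "\<forall>\<^sub>F N in sequentially. b \<noteq> c \<longrightarrow>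
        avg (F N) (\<lambda>u. m (\<lambda>x. a (b * u) x * a (c * u) x)) \<le> \<delta>"
    proof (cases "b = c")
      case False
      then have "b\<^sup>2 \<noteq> c\<^sup>2" using bc B(4) by (auto dest: inj_onD)
      moreover have "b \<noteq> 0" "c \<noteq> 0" using bc B(3) by auto
      ultimately show ?thesis
        using van_der_Corput_correlation[OF h unif, of b c \<delta>] \<open>\<delta> > 0\<close>
        by (auto simp: a_def elim: eventually_mono)
    qed simp
  qed
  from ev1 ev2 show ?thesis
  proof eventually_elim
    case (elim N)
    define c where "c u x = avg B (\<lambda>b. a (b * u) x)" for u x
    have bc: "bdd_fun (c u)" for u
      unfolding c_def by (intro bdd_intros ba)
    have "\<bar>avg (F N) (\<lambda>u. m (\<lambda>x. c u x * f x))\<bar> \<le> e / 2"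
    proof -
      have "(avg (F N) (\<lambda>u. m (\<lambda>x. c u x * f x)))\<^sup>2 \<le> avg (F N) (\<lambda>u. (m (\<lambda>x. c u x * f x))\<^sup>2)"
        by (rule avg_power2_le)
      also have "\<dots> \<le> avg (F N) (\<lambda>u. m (\<lambda>x. (c u x)\<^sup>2))"
      proof (rule avg_mono)
        fix u
        have nn: "0 \<le> m (\<lambda>x. (c u x)\<^sup>2)" by (intro m_nonneg bdd_intros bc) auto
        \<comment> \<open>The norm of \<open>c u\<close> itself serves as the bound
          \<open>\<eta>\<close> in the weak Cauchy-Schwarz inequality.\<close>
        have "\<bar>m (\<lambda>x. c u x * f x)\<bar> \<le> sqrt (m (\<lambda>x. (c u x)\<^sup>2))"
          using nn by (intro abs_m_mult_le bc f) auto
        then show "(m (\<lambda>x. c u x * f x))\<^sup>2 \<le> m (\<lambda>x. (c u x)\<^sup>2)"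
          using nn by (simp add: sqrt_ge_absD)
      qed
      also have "\<dots> = avg (F N) (\<lambda>u. m (\<lambda>x. avg B (\<lambda>b. avg B (\<lambda>b'. a (b * u) x * a (b' * u) x))))"
        by (simp add: c_def power2_eq_square avg_cmult[symmetric] mult.commute)
      also have "\<dots> = avg (F N) (\<lambda>u. avg B (\<lambda>b. avg B (\<lambda>b'. m (\<lambda>x. a (b * u) x * a (b' * u) x))))"
        by (simp add: m_avg bdd_intros ba)
      also have "\<dots> = avg B (\<lambda>b. avg B (\<lambda>b'. avg (F N) (\<lambda>u. m (\<lambda>x. a (b * u) x * a (b' * u) x))))"
        unfolding avg_swap[of "F N"] ..
      also have "\<dots> \<le> avg B (\<lambda>b. avg B (\<lambda>b'. \<delta> + (if b' = b then 1 else 0)))"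
      proof (intro avg_mono)
        fix b b' assume "b \<in> B" "b' \<in> B"
        show "avg (F N) (\<lambda>u. m (\<lambda>x. a (b * u) x * a (b' * u) x)) \<le> \<delta> + (if b' = b then 1 else 0)"
        proof (cases "b' = b")
          case True
          have "\<bar>avg (F N) (\<lambda>u. m (\<lambda>x. a (b * u) x * a (b' * u) x))\<bar> \<le> 1"
            by (intro abs_avg_le abs_m_le) (use a1 in \<open>auto simp: abs_mult intro!: mult_le_one\<close>)
          with True \<open>\<delta> > 0\<close> show ?thesis by simp
        qed (use elim(2) \<open>b \<in> B\<close> \<open>b' \<in> B\<close> in auto)
      qed
      also have "\<dots> = avg B (\<lambda>b. \<delta> + inverse (real n))"
        using B n unfolding avg_def by (simp add: sum.distrib field_simps)
      also have "\<dots> \<le> (e / 2)\<^sup>2"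
        using n B \<open>B \<noteq> {}\<close> by (simp add: avg_const \<delta>_def power2_eq_square)
      finally show ?thesis using \<open>e > 0\<close> by (metis abs_le_square_iff abs_of_pos half_gt_zero)
    qed
    moreover have "\<bar>avg (F N) (\<lambda>u. m (\<lambda>x. c u x * f x)) - avg (F N) (\<lambda>u. m (\<lambda>x. a u x * f x))\<bar> \<le> e / 2"
    proof -
      \<comment> \<open>Exchanging \<open>m\<close> with the averages over \<open>F N\<close>
        reduces the claim to a fixed \<open>x\<close>; asymptotic invariance is uniform over the
        functions \<open>\<lambda>u. a u x\<close>.\<close>
      have "avg (F N) (\<lambda>u. m (\<lambda>x. c u x * f x)) - avg (F N) (\<lambda>u. m (\<lambda>x. a u x * f x))
          = m (\<lambda>x. avg (F N) (\<lambda>u. c u x * f x) - avg (F N) (\<lambda>u. a u x * f x))"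
        by (simp add: m_avg m_diff bdd_intros ba bc bf)
      also have "\<bar>\<dots>\<bar> \<le> e / 2"
      proof (rule abs_m_le)
        fix x
        have "avg (F N) (\<lambda>u. c u x) - avg (F N) (\<lambda>u. a u x)
            = avg B (\<lambda>b. avg (F N) (\<lambda>u. a (b * u) x) - avg (F N) (\<lambda>u. a u x))"
          unfolding c_def avg_diff avg_swap[of "F N"] using B \<open>B \<noteq> {}\<close> by (simp add: avg_const)
        also have "\<bar>\<dots>\<bar> \<le> e / 2"
        proof (rule abs_avg_le)
          fix b assume "b \<in> B"
          then show "\<bar>avg (F N) (\<lambda>u. a (b * u) x) - avg (F N) (\<lambda>u. a u x)\<bar> \<le> e / 2"
            using elim(1)[rule_format, of b "\<lambda>u. a u x"] a1 by simp
        qed (use \<open>e > 0\<close> in simp)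
        finally have 1: "\<bar>avg (F N) (\<lambda>u. c u x) - avg (F N) (\<lambda>u. a u x)\<bar> \<le> e / 2" .
        have "avg (F N) (\<lambda>u. c u x * f x) - avg (F N) (\<lambda>u. a u x * f x)
            = f x * (avg (F N) (\<lambda>u. c u x) - avg (F N) (\<lambda>u. a u x))"
          by (simp add: right_diff_distrib avg_cmult[symmetric] mult.commute)
        also have "\<bar>\<dots>\<bar> \<le> 1 * (e / 2)"
          unfolding abs_mult using f 1 by (intro mult_mono) auto
        finally show "\<bar>avg (F N) (\<lambda>u. c u x * f x) - avg (F N) (\<lambda>u. a u x * f x)\<bar> \<le> e / 2" by simp
      qed
      finally show ?thesis .
    qed
    ultimately show ?case unfolding a_def by linarith
  qed
qed

text \<open>Dilation by \<open>c\<close> turns translation by \<open>s\<close> into translation by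
  \<open>c * s\<close>, and \<open>near\<close> holds for all translations with one constant.
  Midpoints keep the bound because the square is convex.\<close>

lemma mids_dilation_near_translation_invariant:
  assumes "p \<in> mids ((\<lambda>c x. c * x) ` (UNIV - {0})) g" "bdd_fun g"
    and near: "\<And>s. m (\<lambda>x. (g x - g (x + s))\<^sup>2) \<le> C"
  shows "m (\<lambda>x. (p x - p (x + s))\<^sup>2) \<le> C"
  using assms(1)
proof induction
  case (base t)
  then obtain c where c: "c \<noteq> 0" "t = (\<lambda>x. c * x)" by auto
  have "m (\<lambda>x. (g (c * x) - g (c * x + c * s))\<^sup>2) = m (\<lambda>x. (g x - g (x + c * s))\<^sup>2)"
    using c(1) by (intro preservingD[OF dilation] bdd_intros bdd_fun_compose[OF assms(2)])
  then show ?case using near[of "c * s"] by (simp add: c distrib_left)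
next
  case (mid p q)
  note b = bdd_fun_compose[OF bdd_fun_mids[OF mid(1) assms(2)]]
    bdd_fun_compose[OF bdd_fun_mids[OF mid(2) assms(2)]]
  have "m (\<lambda>x. ((p x + q x) / 2 - (p (x + s) + q (x + s)) / 2)\<^sup>2)
      \<le> m (\<lambda>x. ((p x - p (x + s))\<^sup>2 + (q x - q (x + s))\<^sup>2) / 2)"
  proof (intro m_mono bdd_intros b)
    fix x
    have "0 \<le> ((p x - p (x + s)) - (q x - q (x + s)))\<^sup>2" by simp
    then show "((p x + q x) / 2 - (p (x + s) + q (x + s)) / 2)\<^sup>2
        \<le> ((p x - p (x + s))\<^sup>2 + (q x - q (x + s))\<^sup>2) / 2"
      by (simp add: power2_eq_square field_simps)
  qed
  also have "\<dots> = (m (\<lambda>x. (p x - p (x + s))\<^sup>2) + m (\<lambda>x. (q x - q (x + s))\<^sup>2)) / 2"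
    by (subst m_divide m_add, (intro bdd_intros b)+)+ simp
  also have "\<dots> \<le> C" using mid.IH by simp
  finally show ?case .
qed

section \<open>The lower bound for averaged correlations\<close>

text \<open>Under the averages, the factor \<open>f (x / u + u)\<close> is replaced in turn by
  \<open>g (x / u + u)\<close> (van der Corput), \<open>g (x / u)\<close> (near translation
  invariance of \<open>g\<close>), \<open>q (x / u)\<close> (dilation invariance of
  \<open>F\<close>) and \<open>q x\<close> (near dilation invariance of \<open>q\<close>).\<close>

lemma avg_correlation_lower_bound:
  assumes f: "\<And>x. 0 \<le> f x" "\<And>x. f x \<le> 1" and "e > 0"
  shows "\<forall>\<^sub>F N in sequentially. (m f)\<^sup>2 - e \<le> avg (F N) (\<lambda>u. m (\<lambda>x. f (x / u + u) * f x))"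
proof -
  \<comment> \<open>The errors below add up to \<open>7 * \<eta>\<close>: one for each of the four
    replacements, one for the point 0, and two for passing from \<open>m (q * f)\<close> to
    \<open>m (q * q)\<close>.\<close>
  define \<eta> where "\<eta> = e / 8"
  have "\<eta> > 0" and e: "e = 8 * \<eta>" using \<open>e > 0\<close> by (simp_all add: \<eta>_def)
  define Tr where "Tr = range (\<lambda>s x. x + s :: 'a)"
  define Dl where "Dl = (\<lambda>c x. c * x :: 'a) ` (UNIV - {0})"
  have f1: "\<bar>f x\<bar> \<le> 1" for x using f[of x] by simp
  have bf: "bdd_fun f" using f1 by (rule bdd_funI)
  have Tr: "preserving t" "\<exists>s\<in>Tr. \<forall>x. t (s x) = x" if "t \<in> Tr" for t
  proof -
    from that obtain a where a: "t = (\<lambda>x. x + a)" unfolding Tr_def by blast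
    show "preserving t" using translation by (simp add: a)
    have "(\<lambda>x. x + (- a)) \<in> Tr" unfolding Tr_def by (rule rangeI)
    then show "\<exists>s\<in>Tr. \<forall>x. t (s x) = x"
      by (intro bexI[of _ "\<lambda>x. x + (- a)"]) (simp_all add: a)
  qed
  have Tr_comp: "(\<lambda>x. t (s x)) \<in> Tr" if st: "s \<in> Tr" "t \<in> Tr" for s t
  proof -
    from st obtain a b where ab: "t = (\<lambda>x. x + a)" "s = (\<lambda>x. x + b)" unfolding Tr_def by blast
    show ?thesis
      unfolding Tr_def ab by (intro image_eqI[of _ _ "b + a"]) (auto simp: add.assoc)
  qed
  have Dl: "preserving t" "\<exists>s\<in>Dl. \<forall>x. t (s x) = x" if "t \<in> Dl" for t
  proof -
    from that obtain a where a: "a \<noteq> 0" "t = (\<lambda>x. a * x)" unfolding Dl_def by blast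
    show "preserving t" using dilation a by simp
    have "(\<lambda>x. (1 / a) * x) \<in> Dl" unfolding Dl_def using a by (intro imageI) simp
    then show "\<exists>s\<in>Dl. \<forall>x. t (s x) = x"
      using a by (intro bexI[of _ "\<lambda>x. (1 / a) * x"]) simp_all
  qed
  have Dl_comp: "(\<lambda>x. t (s x)) \<in> Dl" if st: "s \<in> Dl" "t \<in> Dl" for s t
  proof -
    from st obtain a b where ab: "a \<noteq> 0" "b \<noteq> 0" "t = (\<lambda>x. a * x)" "s = (\<lambda>x. b * x)"
      unfolding Dl_def by blast
    show ?thesis
      unfolding Dl_def ab using ab by (intro image_eqI[of _ _ "a * b"]) (auto simp: mult.assoc)
  qed
  have ne: "Tr \<noteq> {}" "Dl \<noteq> {}"
    using infinite_field by (auto simp: Tr_def Dl_def dest: finite_subset)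
  have "\<exists>p\<in>mids Tr f. \<forall>t\<in>Tr. m (\<lambda>x. (p x - p (t x))\<^sup>2) \<le> \<eta>\<^sup>2"
  proof (rule mids_near_invariant[OF bf ne(1) \<open>\<eta> > 0\<close>])
    show "preserving t" if "t \<in> Tr" for t
      using that by (rule Tr(1))
    show "(\<lambda>x. t (s x)) \<in> Tr" if "s \<in> Tr" "t \<in> Tr" for s t
      using that by (rule Tr_comp)
  qed
  then obtain g where g: "g \<in> mids Tr f" "\<And>t. t \<in> Tr \<Longrightarrow> m (\<lambda>x. (g x - g (t x))\<^sup>2) \<le> \<eta>\<^sup>2"
    by blast
  have g01: "0 \<le> g x \<and> g x \<le> 1" for x using mids_bounds[OF g(1) f] .
  then have g1: "\<bar>g x\<bar> \<le> 1" for x by simp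
  have bg: "bdd_fun g" using g1 by (rule bdd_funI)
  have "\<exists>p\<in>mids Dl g. \<forall>t\<in>Dl. m (\<lambda>x. (p x - p (t x))\<^sup>2) \<le> \<eta>\<^sup>2"
  proof (rule mids_near_invariant[OF bg ne(2) \<open>\<eta> > 0\<close>])
    show "preserving t" if "t \<in> Dl" for t
      using that by (rule Dl(1))
    show "(\<lambda>x. t (s x)) \<in> Dl" if "s \<in> Dl" "t \<in> Dl" for s t
      using that by (rule Dl_comp)
  qed
  then obtain q where q: "q \<in> mids Dl g" "\<And>t. t \<in> Dl \<Longrightarrow> m (\<lambda>x. (q x - q (t x))\<^sup>2) \<le> \<eta>\<^sup>2"
    by blast
  have gs: "m (\<lambda>x. (g x - g (x + s))\<^sup>2) \<le> \<eta>\<^sup>2" for s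
    using g(2)[of "\<lambda>x. x + s"] by (simp add: Tr_def)
  have q01: "0 \<le> q x \<and> q x \<le> 1" for x
    by (rule mids_bounds[OF q(1)]) (use g01 in auto)
  then have q1: "\<bar>q x\<bar> \<le> 1" for x by simp
  have bq: "bdd_fun q" using q1 by (rule bdd_funI)
  \<comment> \<open>Averaging over dilates keeps near translation invariance, so \<open>q\<close>
    can be paired with both hulls: first \<open>f\<close> is exchanged for \<open>g\<close>, then
    \<open>g\<close> for \<open>q\<close>.\<close>
  have qTr: "m (\<lambda>x. (q x - q (t x))\<^sup>2) \<le> \<eta>\<^sup>2" if "t \<in> Tr" for t
    using that mids_dilation_near_translation_invariant[OF q(1)[unfolded Dl_def] bg gs]
    by (auto simp: Tr_def)
  have 1: "\<bar>m (\<lambda>x. q x * f x) - m (\<lambda>x. q x * g x)\<bar> \<le> \<eta>"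
    using \<open>\<eta> > 0\<close> by (intro mids_inner[OF g(1) bq f1] Tr qTr) auto
  have 2: "\<bar>m (\<lambda>x. q x * g x) - m (\<lambda>x. q x * q x)\<bar> \<le> \<eta>"
    using \<open>\<eta> > 0\<close> by (intro mids_inner[OF q(1) bq g1] Dl q(2)) auto
  have "m q = m f"
    using m_mids[OF q(1) bg Dl(1)] m_mids[OF g(1) bf Tr(1)] by simp
  then have 3: "(m f)\<^sup>2 \<le> m (\<lambda>x. q x * q x)"
    using m_power2_le[OF bq] by (simp add: power2_eq_square)
  have qf: "(m f)\<^sup>2 - 2 * \<eta> \<le> m (\<lambda>x. q x * f x)"
    using 1 2 3 by linarith

  have ev1: "\<forall>\<^sub>F N in sequentially. \<bar>avg (F N) (\<lambda>u. m (\<lambda>x. (f (x / u + u) - g (x / u + u)) * f x))\<bar> \<le> \<eta>"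
  proof (rule van_der_Corput[where h = "\<lambda>x. f x - g x"])
    show "\<bar>f x - g x\<bar> \<le> 1" for x using f[of x] g01[of x] by linarith
    fix k :: 'a and e' :: real assume "k \<noteq> 0" "e' > 0"
    show "\<forall>\<^sub>F N in sequentially. \<forall>y. \<bar>avg (F N) (\<lambda>u. f (y + k * u) - g (y + k * u))\<bar> \<le> e'"
    proof (rule mids_asym_inv[OF g(1) f1 _ \<open>e' > 0\<close>])
      fix t assume "t \<in> Tr"
      then obtain s where "t = (\<lambda>x. x + s)" by (auto simp: Tr_def)
      \<comment> \<open>Adding \<open>s\<close> to \<open>y + k * u\<close> is the same as adding
        \<open>s / k\<close> to \<open>u\<close>.\<close>
      then show "\<exists>S. asym_inv F S \<and> (\<forall>y u. t (y + k * u) = y + k * S u)"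
        using \<open>k \<noteq> 0\<close> double_Folner_translation[OF Folner]
        by (intro exI[of _ "\<lambda>u. u + s / k"]) (auto simp: distrib_left)
    qed
  qed (use f1 \<open>\<eta> > 0\<close> in auto)
  have ev2: "\<forall>\<^sub>F N in sequentially. \<forall>x. \<bar>avg (F N) (\<lambda>u. g (x / u) - q (x / u))\<bar> \<le> \<eta>"
  proof (rule mids_asym_inv[OF q(1) g1 _ \<open>\<eta> > 0\<close>])
    fix t assume "t \<in> Dl"
    then obtain c where "c \<noteq> 0" "t = (\<lambda>x. c * x)" by (auto simp: Dl_def)
    \<comment> \<open>Multiplying \<open>x / u\<close> by \<open>c\<close> is the same as dividing
      \<open>u\<close> by \<open>c\<close>; at \<open>u = 0\<close> both sides are 0.\<close>
    then show "\<exists>S. asym_inv F S \<and> (\<forall>x u. t (x / u) = x / S u)"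
      using double_Folner_dilation[OF Folner, of "1 / c"]
      by (intro exI[of _ "\<lambda>u. (1 / c) * u"]) (auto simp: mult.commute)
  qed
  have ev3: "\<forall>\<^sub>F N in sequentially. avg (F N) (indicator {0}) \<le> \<eta>"
    using \<open>\<eta> > 0\<close> by (intro double_Folner_singleton Folner infinite_field) auto

  \<comment> \<open>Dilation by \<open>1 / u\<close> transports the near invariance of
    \<open>g\<close> under translation by \<open>u\<close>. At \<open>u = 0\<close> the two
    arguments of \<open>g\<close> coincide.\<close>
  have gu: "m (\<lambda>x. g (x / u) * f x) - \<eta> \<le> m (\<lambda>x. g (x / u + u) * f x)" for u
  proof (cases "u = 0")
    case False
    have "m (\<lambda>x. (g ((1 / u) * x) - g ((1 / u) * x + u))\<^sup>2) = m (\<lambda>x. (g x - g (x + u))\<^sup>2)"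
      using False by (intro preservingD[OF dilation] bdd_intros bdd_fun_compose[OF bg]) auto
    then have "m (\<lambda>x. (g (x / u) - g (x / u + u))\<^sup>2) \<le> \<eta>\<^sup>2" using gs[of u] by simp
    then have "\<bar>m (\<lambda>x. (g (x / u) - g (x / u + u)) * f x)\<bar> \<le> \<eta>"
      using \<open>\<eta> > 0\<close> by (intro abs_m_mult_le bdd_intros bdd_fun_compose[OF bg] f1) auto
    then show ?thesis
      by (simp add: left_diff_distrib m_diff bdd_intros bdd_fun_compose[OF bg] bf)
  qed (use \<open>\<eta> > 0\<close> in simp)
  \<comment> \<open>At \<open>u = 0\<close> the function \<open>q (x / u)\<close> is the constant
    \<open>q 0\<close>, and only the trivial loss of 1 is available; the indicator records
    it.\<close>
  have qu: "m (\<lambda>x. q x * f x) - \<eta> - indicator {0} u \<le> m (\<lambda>x. q (x / u) * f x)" for u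
  proof (cases "u = 0")
    case True
    have "0 \<le> m (\<lambda>x. q (x / u) * f x)"
      using q01 f by (intro m_nonneg bdd_intros bdd_fun_compose[OF bq] bf) auto
    moreover have "\<bar>m (\<lambda>x. q x * f x)\<bar> \<le> 1"
      using q1 f1 by (intro abs_m_le) (auto simp: abs_mult intro!: mult_le_one)
    ultimately show ?thesis using True \<open>\<eta> > 0\<close> by simp
  next
    case False
    have "(\<lambda>x. (1 / u) * x) \<in> Dl" unfolding Dl_def using False by (intro imageI) simp
    from q(2)[OF this] have "\<bar>m (\<lambda>x. (q x - q (x / u)) * f x)\<bar> \<le> \<eta>"
      using \<open>\<eta> > 0\<close> by (intro abs_m_mult_le bdd_intros bdd_fun_compose[OF bq] bq f1) auto
    then show ?thesis
      using False by (simp add: left_diff_distrib m_diff bdd_intros bdd_fun_compose[OF bq] bq bf)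
  qed
  from ev1 ev2 ev3 show ?thesis
  proof eventually_elim
    case (elim N)
    note b = bdd_fun_compose[OF bf] bdd_fun_compose[OF bg] bdd_fun_compose[OF bq]
    have "avg (F N) (\<lambda>u. m (\<lambda>x. f (x / u + u) * f x))
        = avg (F N) (\<lambda>u. m (\<lambda>x. (f (x / u + u) - g (x / u + u)) * f x))
          + avg (F N) (\<lambda>u. m (\<lambda>x. g (x / u + u) * f x))"
      by (simp add: avg_add[symmetric] left_diff_distrib m_diff bdd_intros b bf)
    moreover have "avg (F N) (\<lambda>u. m (\<lambda>x. g (x / u) * f x)) - \<eta>
        \<le> avg (F N) (\<lambda>u. m (\<lambda>x. g (x / u + u) * f x))"
      using avg_mono[of "F N", OF gu] by (simp add: avg_diff avg_const)
    moreover have "\<bar>avg (F N) (\<lambda>u. m (\<lambda>x. g (x / u) * f x)) - avg (F N) (\<lambda>u. m (\<lambda>x. q (x / u) * f x))\<bar> \<le> \<eta>"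
    proof -
      have "avg (F N) (\<lambda>u. m (\<lambda>x. g (x / u) * f x)) - avg (F N) (\<lambda>u. m (\<lambda>x. q (x / u) * f x))
          = m (\<lambda>x. avg (F N) (\<lambda>u. f x * (g (x / u) - q (x / u))))"
        by (simp add: m_avg bdd_intros b bf avg_diff[symmetric] m_diff[symmetric] right_diff_distrib
            mult.commute)
      also have "\<bar>\<dots>\<bar> \<le> \<eta>"
      proof (rule abs_m_le)
        fix x
        have "\<bar>f x\<bar> * \<bar>avg (F N) (\<lambda>u. g (x / u) - q (x / u))\<bar> \<le> 1 * \<eta>"
          using f1 elim(2) by (intro mult_mono) auto
        then show "\<bar>avg (F N) (\<lambda>u. f x * (g (x / u) - q (x / u)))\<bar> \<le> \<eta>"
          by (simp add: avg_cmult abs_mult)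
      qed
      finally show ?thesis .
    qed
    moreover have "m (\<lambda>x. q x * f x) - \<eta> - avg (F N) (indicator {0}) \<le> avg (F N) (\<lambda>u. m (\<lambda>x. q (x / u) * f x))"
      using avg_mono[of "F N", OF qu] by (simp add: avg_diff avg_const)
    ultimately show ?case using elim(1,3) qf \<open>\<eta> > 0\<close> e by linarith
  qed
qed

end

section \<open>A mean attaining the upper density\<close>

lemma avg_indicator: "finite A \<Longrightarrow> avg A (indicator S) = real (card (S \<inter> A)) / real (card A)"
  by (simp add: avg_def indicator_def sum.If_cases Int_commute)

text \<open>The ratios lie between 0 and 1, so both limits are finite and the real densities can be
  used in the limit theorems for extended reals.\<close>

lemma ereal_upper_dens: "ereal (upper_dens F S) = limsup (\<lambda>N. ereal (real (card (S \<inter> F N)) / real (card (F N))))"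
  and ereal_lower_dens: "ereal (lower_dens F S) = liminf (\<lambda>N. ereal (real (card (S \<inter> F N)) / real (card (F N))))"
  if "\<And>N. finite (F N)" for F :: "nat \<Rightarrow> 'a set"
proof -
  let ?R = "\<lambda>N. ereal (real (card (S \<inter> F N)) / real (card (F N)))"
  have R: "0 \<le> ?R N" "?R N \<le> 1" for N
    using card_mono[OF that, of "S \<inter> F N" N] by (auto simp: divide_le_eq_1)
  have "0 \<le> liminf ?R" "liminf ?R \<le> limsup ?R" "limsup ?R \<le> 1"
    using R by (auto intro!: Liminf_bounded Limsup_bounded Liminf_le_Limsup)
  then have "\<bar>limsup ?R\<bar> \<noteq> \<infinity>" "\<bar>liminf ?R\<bar> \<noteq> \<infinity>" by auto
  then show "ereal (upper_dens F S) = limsup ?R" "ereal (lower_dens F S) = liminf ?R"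
    unfolding upper_dens_def lower_dens_def by (simp_all add: ereal_real')
qed

text \<open>By Tychonoff's theorem the averages cluster along a subsequence \<open>r\<close> that
  realises the upper density of \<open>E\<close>. Refining \<open>r\<close> fixes the value at
  \<open>E\<close>; refining \<open>sequentially\<close> gives affine invariance and keeps every
  limit of ratios below the upper density.\<close>

lemma exists_affine_mean:
  fixes F :: "nat \<Rightarrow> 'a::field set"
  assumes F: "double_Folner F" and inf: "infinite (UNIV :: 'a set)"
  obtains m where "affine_mean m F" "m (indicator E) = upper_dens F E"
    "\<And>S. m (indicator S) \<le> upper_dens F S"
proof -
  have fin: "finite (F N)" "F N \<noteq> {}" for N using F by (auto simp: double_Folner_def)
  let ?R = "\<lambda>S N. real (card (S \<inter> F N)) / real (card (F N))"
  obtain r where r: "strict_mono r" "((\<lambda>N. ereal (?R E N)) \<circ> r) \<longlonglongrightarrow> limsup (\<lambda>N. ereal (?R E N))"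
    using limsup_subseq_lim by blast
  \<comment> \<open>The averages, as points of a product of compact intervals indexed by all functions,
    have a cluster point; \<open>U\<close> is a filter along which they converge to it.\<close>
  define X where "X N f = (if bdd_fun f then avg (F N) f else 0)" for N f
  define B where "B f = (SOME C. 0 \<le> C \<and> (bdd_fun f \<longrightarrow> (\<forall>x. \<bar>f x\<bar> \<le> C)))" for f :: "'a \<Rightarrow> real"
  have B: "0 \<le> B f \<and> (bdd_fun f \<longrightarrow> (\<forall>x. \<bar>f x\<bar> \<le> B f))" for f
    unfolding B_def
  proof (rule someI_ex)
    show "\<exists>C. 0 \<le> C \<and> (bdd_fun f \<longrightarrow> (\<forall>x. \<bar>f x\<bar> \<le> C))"
      by (metis abs_ge_zero bdd_fun_def order_refl order_trans)
  qed
  define K where "K = (\<Pi>\<^sub>E f\<in>UNIV. {- B f .. B f})"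
  have "compactin (product_topology (\<lambda>f :: 'a \<Rightarrow> real. euclidean :: real topology) UNIV) K"
    unfolding K_def by (simp add: compactin_PiE)
  then have "compact K" by (simp add: euclidean_product_topology)
  have XK: "X N \<in> K" for N
    unfolding K_def X_def
    using B abs_avg_le[of "B _" "F N"] by (auto simp: abs_le_iff minus_le_iff)
  let ?G = "filtermap (\<lambda>k. X (r k)) sequentially"
  have "?G \<noteq> bot" "eventually (\<lambda>x. x \<in> K) ?G"
    using XK by (auto simp: filtermap_bot_iff eventually_filtermap)
  then obtain m where m: "inf (nhds m) ?G \<noteq> bot"
    using \<open>compact K\<close> unfolding compact_filter by blast
  \<comment> \<open>The first filter forces \<open>X\<close> to converge to \<open>m\<close>, the
    second keeps the indices in the range of \<open>r\<close>. They are compatible because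
    \<open>m\<close> is a cluster point along \<open>r\<close>.\<close>
  define U where "U = inf (filtercomap X (nhds m)) (filtermap r sequentially)"
  have "U \<noteq> bot"
  proof
    assume "U = bot"
    then obtain P Q where P: "eventually P (nhds m)" and Q: "eventually Q (filtermap r sequentially)"
      and PQ: "\<And>N. P (X N) \<Longrightarrow> Q N \<Longrightarrow> False"
      unfolding U_def trivial_limit_def eventually_inf eventually_filtercomap by metis
    from Q have "eventually (\<lambda>x. \<not> P x) ?G"
      unfolding eventually_filtermap by (rule eventually_mono) (use PQ in blast)
    with P have "eventually (\<lambda>x. False) (inf (nhds m) ?G)"
      unfolding eventually_inf by blast
    with m show False by (simp add: trivial_limit_def)
  qed
  have Ur: "U \<le> filtermap r sequentially" by (simp add: U_def)
  have "filtermap r sequentially \<le> sequentially"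
    using filterlim_subseq[OF r(1)] by (simp add: filterlim_def)
  with Ur have Us: "U \<le> sequentially" by (rule order_trans)
  have "filterlim X (nhds m) U"
    by (simp add: filterlim_iff_le_filtercomap U_def)
  then have Xlim: "((\<lambda>N. X N f) \<longlongrightarrow> m f) U" for f
    by (rule continuous_on_tendsto_compose[OF continuous_on_product_coordinates]) auto
  have lim: "((\<lambda>N. avg (F N) f) \<longlongrightarrow> m f) U" if "bdd_fun f" for f
    using Xlim[of f] that by (simp add: X_def)
  note uniq = tendsto_unique[OF \<open>U \<noteq> bot\<close>]
  interpret mean m
  proof
    fix f g :: "'a \<Rightarrow> real" assume f: "bdd_fun f" and g: "bdd_fun g"
    show "m (\<lambda>x. f x + g x) = m f + m g"
      by (rule uniq[OF lim[OF bdd_fun_add[OF f g]]])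
        (simp add: avg_add tendsto_add lim f g)
    show "m f \<le> m g" if "\<And>x. f x \<le> g x"
      using that by (intro tendsto_le[OF \<open>U \<noteq> bot\<close> lim[OF g] lim[OF f]] always_eventually allI avg_mono)
  next
    fix c f assume f: "bdd_fun (f :: 'a \<Rightarrow> real)"
    show "m (\<lambda>x. c * f x) = c * m f"
      by (rule uniq[OF lim[OF bdd_fun_mult[OF bdd_fun_const f]]])
        (simp add: avg_cmult tendsto_mult_left lim f)
  next
    show "m (\<lambda>x. 1) = 1"
      by (rule uniq[OF lim[OF bdd_fun_const]]) (simp add: avg_const fin)
  qed
  have pres: "preserving t" if t: "asym_inv F t" for t
    unfolding preserving_def
  proof (intro allI impI)
    fix f :: "'a \<Rightarrow> real" assume f: "bdd_fun f"
    then obtain C where C: "\<And>x. \<bar>f x\<bar> \<le> C" by (auto simp: bdd_fun_def)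
    have "((\<lambda>N. avg (F N) (\<lambda>x. f (t x)) - avg (F N) f) \<longlongrightarrow> 0) U"
    proof (rule tendstoI)
      fix e :: real assume "e > 0"
      have "\<forall>\<^sub>F N in sequentially. dist (avg (F N) (\<lambda>x. f (t x)) - avg (F N) f) 0 < e"
        using asym_invD[OF t half_gt_zero[OF \<open>e > 0\<close>], of C]
      proof eventually_elim
        case (elim N)
        have "\<bar>avg (F N) (\<lambda>x. f (t x)) - avg (F N) f\<bar> \<le> e / 2" using elim C by blast
        then show ?case using \<open>e > 0\<close> by (simp add: dist_real_def)
      qed
      then show "\<forall>\<^sub>F N in U. dist (avg (F N) (\<lambda>x. f (t x)) - avg (F N) f) 0 < e"
        using Us by (rule filter_leD[rotated])
    qed
    then have "((\<lambda>N. (avg (F N) (\<lambda>x. f (t x)) - avg (F N) f) + avg (F N) f) \<longlongrightarrow> 0 + m f) U"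
      by (intro tendsto_add lim f)
    then show "m (\<lambda>x. f (t x)) = m f"
      by (intro uniq[OF lim[OF bdd_fun_compose[OF f]]]) simp
  qed
  have "affine_mean m F"
    by unfold_locales
      (use F inf in \<open>auto intro: pres double_Folner_translation double_Folner_dilation\<close>)
  moreover have Rlim: "(?R S \<longlongrightarrow> m (indicator S)) U" for S
  proof -
    have "bdd_fun (indicator S :: 'a \<Rightarrow> real)" by (rule bdd_funI[of _ 1]) (simp add: indicator_def)
    from lim[OF this] show ?thesis by (simp add: avg_indicator fin)
  qed
  have "m (indicator E) = upper_dens F E"
  proof -
    have "filterlim (\<lambda>N. ereal (?R E N)) (nhds (limsup (\<lambda>N. ereal (?R E N)))) (filtermap r sequentially)"
      using r(2) by (simp add: filterlim_def filtermap_filtermap comp_def)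
    then have "filterlim (\<lambda>N. ereal (?R E N)) (nhds (ereal (upper_dens F E))) U"
      using filterlim_mono[OF _ order_refl Ur] by (simp add: ereal_upper_dens fin)
    then show ?thesis using uniq[OF Rlim] by (simp add: tendsto_ereal)
  qed
  moreover have "m (indicator S) \<le> upper_dens F S" for S
  \<comment> \<open>Any \<open>c\<close> above the limsup eventually bounds the ratios strictly, and
    the limit along \<open>U\<close> inherits the bound.\<close>
  proof (rule dense_ge)
    fix c assume "upper_dens F S < c"
    then have "limsup (\<lambda>N. ereal (?R S N)) < ereal c"
      by (simp add: ereal_upper_dens[OF fin(1), symmetric])
    then have "\<forall>\<^sub>F N in sequentially. ?R S N < c"
      by (auto dest: Limsup_lessD)
    then have "\<forall>\<^sub>F N in U. ?R S N \<le> c"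
      by (intro filter_leD[OF Us]) (auto elim: eventually_mono)
    then show "m (indicator S) \<le> c"
      using tendsto_upperbound[OF Rlim _ \<open>U \<noteq> bot\<close>] by blast
  qed
  ultimately show ?thesis using that by blast
qed

section \<open>Counting the parameters with large correlation\<close>

theorem theorem2p3:
  fixes F :: "nat \<Rightarrow> 'a::field set" and E :: "'a set" and \<epsilon> :: real
  assumes "countable (UNIV :: 'a set)" and "infinite (UNIV :: 'a set)"
    and "double_Folner F"
    and "upper_dens F E > 0"
    and "\<epsilon> > 0"
  shows "\<exists>D. D \<subseteq> UNIV - {0} \<and>
    lower_dens F D \<ge> \<epsilon> / (\<epsilon> + upper_dens F E - (upper_dens F E)\<^sup>2) \<and>
    (\<forall>u\<in>D. upper_dens F ((\<lambda>x. x - u) ` E \<inter> (\<lambda>x. x / u) ` E) > (upper_dens F E)\<^sup>2 - \<epsilon>)"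
proof -
  obtain m where "affine_mean m F" and mE: "m (indicator E) = upper_dens F E"
    and upper: "\<And>S. m (indicator S) \<le> upper_dens F S"
    using exists_affine_mean[OF assms(3,2)] by blast
  interpret affine_mean m F by fact
  define d where "d = upper_dens F E"
  define f :: "'a \<Rightarrow> real" where "f = indicator E"
  have f01: "0 \<le> f x" "f x \<le> 1" for x by (auto simp: f_def indicator_def)
  have bf: "bdd_fun f" using f01 by (intro bdd_funI[of _ 1]) auto
  have mf: "m f = d" using mE by (simp add: f_def d_def)
  have "\<bar>m f\<bar> \<le> 1" using f01 by (intro abs_m_le) auto
  then have d: "0 \<le> d" "d \<le> 1" using assms(4) mf by (auto simp: d_def)
  \<comment> \<open>The gap between the upper bound \<open>d\<close> of the correlation and the
    threshold \<open>d^2 - \<epsilon>\<close>.\<close>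
  define c where "c = \<epsilon> + d - d\<^sup>2"
  have "d\<^sup>2 \<le> d" using d by (simp add: power2_eq_square mult_left_le)
  then have "c > 0" using \<open>\<epsilon> > 0\<close> by (simp add: c_def)
  \<comment> \<open>The correlation of \<open>f (x + u)\<close> and \<open>f (x * u)\<close> after the substitution \<open>x \<mapsto> x / u\<close>;
    at \<open>u = 0\<close> it has the junk value given by \<open>x / 0 = 0\<close>.\<close>
  define \<phi> where "\<phi> = (\<lambda>u. m (\<lambda>x. f (x / u + u) * f x))"
  have \<phi>_le: "\<phi> u \<le> d" for u
    unfolding mf[symmetric] \<phi>_def
    by (intro m_mono bdd_intros bdd_fun_compose[OF bf] bf) (simp add: mult_left_le_one_le f01)
  have \<phi>_upper: "\<phi> u \<le> upper_dens F ((\<lambda>x. x - u) ` E \<inter> (\<lambda>x. x / u) ` E)" if "u \<noteq> 0" for u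
  proof -
    have "\<phi> u = m (\<lambda>x. f ((u * x) / u + u) * f (u * x))"
      unfolding \<phi>_def using that
      by (intro preservingD[OF dilation, symmetric] bdd_intros bdd_fun_compose[OF bf])
    also have "(\<lambda>x. f ((u * x) / u + u) * f (u * x)) = indicator ((\<lambda>x. x - u) ` E \<inter> (\<lambda>x. x / u) ` E)"
    proof
      fix x
      have "x \<in> (\<lambda>x. x - u) ` E \<longleftrightarrow> x + u \<in> E" by force
      moreover have "x \<in> (\<lambda>x. x / u) ` E \<longleftrightarrow> u * x \<in> E"
        using that by (force simp: image_iff)
      ultimately show "f ((u * x) / u + u) * f (u * x) = indicator ((\<lambda>x. x - u) ` E \<inter> (\<lambda>x. x / u) ` E) x"
        using that by (auto simp: f_def indicator_def)
    qed
    finally show ?thesis using upper by simp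
  qed
  define D where "D = {u. u \<noteq> 0 \<and> d\<^sup>2 - \<epsilon> < \<phi> u}"
  have "\<epsilon> / c \<le> lower_dens F D"
  \<comment> \<open>The tolerance \<open>c * e / 2\<close> for the averaged correlation becomes
    \<open>e / 2\<close> after division by \<open>c\<close>; the other \<open>e / 2\<close> covers
    the point 0.\<close>
  proof (rule field_le_epsilon)
    fix e :: real assume "e > 0"
    have "\<forall>\<^sub>F N in sequentially. d\<^sup>2 - c * e / 2 \<le> avg (F N) \<phi>"
      using avg_correlation_lower_bound[of f, OF f01, of "c * e / 2"] \<open>c > 0\<close> \<open>e > 0\<close>
      by (simp add: mf \<phi>_def)
    moreover have "\<forall>\<^sub>F N in sequentially. avg (F N) (indicator {0}) \<le> e / 2"
      using \<open>e > 0\<close> by (intro double_Folner_singleton Folner infinite_field) auto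
    ultimately have "\<forall>\<^sub>F N in sequentially. ereal (\<epsilon> / c - e) \<le> ereal (real (card (D \<inter> F N)) / real (card (F N)))"
    proof eventually_elim
      case (elim N)
      \<comment> \<open>Off \<open>D\<close> and 0 the correlation is at most the threshold;
        elsewhere it is at most \<open>d\<close>, which is the threshold plus \<open>c\<close>. The
        point 0 needs its own term, being excluded from \<open>D\<close>.\<close>
      have "avg (F N) \<phi> \<le> avg (F N) (\<lambda>u. (d\<^sup>2 - \<epsilon>) + (c * indicator D u + c * indicator {0} u))"
      proof (rule avg_mono)
        fix u
        show "\<phi> u \<le> (d\<^sup>2 - \<epsilon>) + (c * indicator D u + c * indicator {0} u)"
          using \<phi>_le[of u] by (auto simp: indicator_def D_def c_def)
      qed
      also have "\<dots> = (d\<^sup>2 - \<epsilon>) + (c * avg (F N) (indicator D) + c * avg (F N) (indicator {0}))"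
        by (simp add: avg_add avg_cmult avg_const)
      finally have "\<epsilon> - c * e / 2 \<le> c * (avg (F N) (indicator D) + avg (F N) (indicator {0}))"
        using elim(1) by (simp add: distrib_left)
      also have "\<dots> \<le> c * (avg (F N) (indicator D) + e / 2)"
        using elim(2) \<open>c > 0\<close> by (intro mult_left_mono) auto
      finally have "\<epsilon> / c - e \<le> avg (F N) (indicator D)"
        using \<open>c > 0\<close> by (simp add: field_simps)
      then show ?case by (simp add: avg_indicator)
    qed
    then have "ereal (\<epsilon> / c - e) \<le> ereal (lower_dens F D)"
      unfolding ereal_lower_dens[OF finite_Folner] by (rule Liminf_bounded)
    then show "\<epsilon> / c \<le> lower_dens F D + e" by simp
  qed
  moreover have "D \<subseteq> UNIV - {0}" by (auto simp: D_def)
  moreover have "d\<^sup>2 - \<epsilon> < upper_dens F ((\<lambda>x. x - u) ` E \<inter> (\<lambda>x. x / u) ` E)" if "u \<in> D" for u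
    using that \<phi>_upper[of u] by (auto simp: D_def)
  ultimately show ?thesis unfolding c_def d_def by blast
qed

end
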